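(* For every integer $k\ge 1$, $$G_{1\text{-}3\text{-}2}^{12\ldots k}(x)=x^kC^2(x),$$ where $G_{1\text{-}3\text{-}2}^{12\ldots k}(x)$ is the ordinary generating function $\sum_{n\ge 1}N(n)x^n$, with $N(n)$ the number of permutations of $\{1,\dots,n\}$ that avoid the classical pattern $1\text{-}3\text{-}2$ and begin with the pattern $12\ldots k$.
   Context: A permutation $\pi=\pi_1\cdots\pi_n$ avoids the classical pattern $1\text{-}3\text{-}2$ if there are no indices $a<b<c$ with $\pi_a<\pi_c<\pi_b$. It begins with the pattern $12\ldots k$ if $n\ge k$ and $\pi_1<\pi_2<\cdots<\pi_k$. The empty permutation is not counted. $C(x)=\sum_{n\ge0}C_nx^n=\frac{1-\sqrt{1-4x}}{2x}$ is the generating function of the Catalan numbers $C_n$, and $C^j(x)=(C(x))^j$. *)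

theory Defs
  imports
    Complex_Main
    "HOL-Computational_Algebra.Formal_Power_Series"
    "HOL-Combinatorics.Multiset_Permutations"
begin

definition avoids_132 :: "nat list \<Rightarrow> bool" where
  "avoids_132 p \<longleftrightarrow>
     \<not> (\<exists>a b c. a < b \<and> b < c \<and> c < length p \<and> p ! a < p ! c \<and> p ! c < p ! b)"

definition begins_increasing :: "nat \<Rightarrow> nat list \<Rightarrow> bool" where
  "begins_increasing k p \<longleftrightarrow> k \<le> length p \<and> sorted_wrt (<) (take k p)"

text \<open>Permutations of \<open>{1..n}\<close> are represented in one-line notation, as lists.\<close>

definition num_perms :: "nat \<Rightarrow> nat \<Rightarrow> nat" where
  "num_perms k n = card {p \<in> permutations_of_set {1..n}. avoids_132 p \<and> begins_increasing k p}"

text \<open>The empty permutation is not counted, so the constant coefficient is zero.\<close>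

definition perm_gf :: "nat \<Rightarrow> real fps" where
  "perm_gf k = Abs_fps (\<lambda>n. if n = 0 then 0 else of_nat (num_perms k n))"

definition catalan :: "nat \<Rightarrow> real" where
  "catalan n = of_nat ((2 * n) choose n) / of_nat (n + 1)"

definition catalan_gf :: "real fps" where
  "catalan_gf = Abs_fps catalan"

text \<open>The closed form \<open>C(x) = (1 - sqrt (1 - 4 x)) / (2 x)\<close>.\<close>

lemma gchoose_half_catalan:
  "((1/2 :: real) gchoose Suc n) * (-4) ^ Suc n = - 2 * catalan n"
proof (induction n)
  case 0
  show ?case by (simp add: catalan_def)
next
  case (Suc n)
  have cat: "catalan (Suc n) * of_nat (n + 2) = 2 * of_nat (2 * n + 1) * catalan n"
  proof -
    have e: "fact (2 * Suc n) = (real (2 * n + 2)) * (real (2 * n + 1)) * fact (2 * n)"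
      by (simp add: algebra_simps)
    have c: "real ((2 * m) choose m) = fact (2 * m) / (fact m * fact m)" for m
      by (simp add: binomial_fact)
    show ?thesis
      unfolding catalan_def c e by (simp add: divide_simps) (simp add: algebra_simps)
  qed
  have step: "((1/2 :: real) gchoose Suc (Suc n)) * of_nat (n + 2)
      = ((1/2) gchoose Suc n) * (1/2 - of_nat (Suc n))"
    using gbinomial_mult_1[of "1/2 :: real" "Suc n"] by (simp add: algebra_simps)
  have "((1/2 :: real) gchoose Suc (Suc n)) * (-4) ^ Suc (Suc n) * of_nat (n + 2)
      = (((1/2 :: real) gchoose Suc (Suc n)) * of_nat (n + 2)) * (-4) ^ Suc n * (-4)"
    by simp
  also have "\<dots> = (((1/2) gchoose Suc n) * (-4) ^ Suc n) * ((1/2 - of_nat (Suc n)) * (-4))"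
    unfolding step by (simp only: mult_ac)
  also have "\<dots> = - 2 * (2 * of_nat (2 * n + 1) * catalan n)"
    unfolding Suc.IH by (simp add: algebra_simps)
  also have "\<dots> = - 2 * catalan (Suc n) * of_nat (n + 2)"
    unfolding cat[symmetric] by simp
  finally show ?case
    by (metis (no_types, lifting) mult_right_cancel of_nat_eq_0_iff add_is_0 zero_neq_numeral)
qed

lemma catalan_gf_closed_form:
  "catalan_gf = (1 - fps_radical root 2 (1 - 4 * fps_X)) / (2 * fps_X)"
proof -
  define s where "s = fps_compose (fps_binomial (1/2 :: real)) (fps_const (-4) * fps_X)"
  have "s ^ 2 = fps_compose (fps_binomial (1/2 :: real) ^ 2) (fps_const (-4) * fps_X)"
    unfolding s_def by (simp add: fps_compose_power)
  also have "fps_binomial (1/2 :: real) ^ 2 = 1 + fps_X"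
    by (simp add: fps_binomial_power fps_binomial_1)
  also have "fps_compose (1 + fps_X) (fps_const (-4) * fps_X) = (1 - 4 * fps_X :: real fps)"
    by (simp add: fps_compose_add_distrib numeral_fps_const flip: fps_const_neg)
  finally have s2: "s ^ Suc 1 = 1 - 4 * fps_X" by (simp add: numeral_2_eq_2)
  have s0: "fps_nth s 0 = 1" by (simp add: s_def)
  have "s = fps_radical root (Suc 1) (1 - 4 * fps_X)"
    using radical_unique[of root 1 "1 - 4 * fps_X" s] s2 s0 by simp
  hence s: "fps_radical root 2 (1 - 4 * fps_X) = s" by (simp add: numeral_2_eq_2)
  have "1 - s = catalan_gf * (2 * fps_X)"
  proof (rule fps_ext)
    fix n
    have c: "catalan_gf * (2 * fps_X) = fps_const 2 * (fps_X * catalan_gf)"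
      by (simp add: numeral_fps_const mult_ac)
    show "fps_nth (1 - s) n = fps_nth (catalan_gf * (2 * fps_X)) n"
    proof (cases n)
      case 0
      thus ?thesis by (simp add: s0)
    next
      case (Suc m)
      have "fps_nth (1 - s) (Suc m) = - (((1/2 :: real) gchoose Suc m) * (-4) ^ Suc m)"
        by (simp only: s_def fps_nth_compose_linear fps_binomial_nth fps_sub_nth fps_one_nth) simp
      thus ?thesis
        unfolding Suc gchoose_half_catalan c by (simp add: catalan_gf_def)
    qed
  qed
  thus ?thesis unfolding s by simp
qed

end

theory Submission
  imports Defs
begin

text \<open>
  A nonempty permutation that avoids \<open>1-3-2\<close> is cut at its maximum as \<open>L M R\<close>.  An entry of
  \<open>L\<close> smaller than an entry of \<open>R\<close> would form the pattern together with \<open>M\<close>, so all of \<open>L\<close> lies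
  above all of \<open>R\<close>; conversely any two avoiders can be put together in this way (lemma
  \<open>bij_betw_glue\<close>).  The permutation begins with \<open>12\<dots>k\<close> iff either \<open>L\<close> already does, or
  \<open>L\<close> is the increasing permutation of length \<open>k - 1\<close>, so that \<open>M\<close> completes the run; the run
  cannot continue beyond \<open>M\<close>.

  Let \<open>A\<close> be the generating function of all avoiders, the empty one included, and let \<open>G\<close> be the
  generating function for a fixed \<open>k \<ge> 1\<close>.  The decomposition reads
  \<open>A = 1 + x A\<^sup>2\<close> and \<open>G = x (G + x\<^bsup>k-1\<^esup>) A\<close>.  The first equation has only one solution
  among formal power series, and \<open>C\<close> satisfies it, so \<open>A = C\<close>.  The second one becomes
  \<open>G (1 - x C) = x\<^sup>k C\<close>, and multiplying by \<open>C\<close> yields the claim because \<open>C (1 - x C) = 1\<close>.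
\<close>

section \<open>Cutting a list at its maximum\<close>

text \<open>
  This recursive form makes avoidance amenable to list induction: a new first entry can only
  play the role of the \<open>1\<close>.
\<close>

lemma avoids_132_Cons:
  "avoids_132 (x # xs) \<longleftrightarrow> sorted_wrt (\<lambda>b c. \<not> (x < c \<and> c < b)) xs \<and> avoids_132 xs"
proof
  assume av: "avoids_132 (x # xs)"
  have "\<not> (x < xs ! j \<and> xs ! j < xs ! i)" if "i < j" "j < length xs" for i j
    using av that unfolding avoids_132_def
    by (metis Suc_less_eq length_Cons nth_Cons_0 nth_Cons_Suc zero_less_Suc)
  moreover have "avoids_132 xs"
    using av unfolding avoids_132_def
    by (metis Suc_less_eq length_Cons nth_Cons_Suc)
  ultimately show "sorted_wrt (\<lambda>b c. \<not> (x < c \<and> c < b)) xs \<and> avoids_132 xs"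
    by (simp add: sorted_wrt_iff_nth_less)
next
  assume R: "sorted_wrt (\<lambda>b c. \<not> (x < c \<and> c < b)) xs \<and> avoids_132 xs"
  show "avoids_132 (x # xs)"
    unfolding avoids_132_def
  proof safe
    fix a b c
    assume abc: "a < b" "b < c" "c < length (x # xs)"
      "(x # xs) ! a < (x # xs) ! c" "(x # xs) ! c < (x # xs) ! b"
    obtain b' c' where [simp]: "b = Suc b'" "c = Suc c'"
      using abc by (metis less_imp_Suc_add)
    show False
    proof (cases a)
      case 0
      thus ?thesis using abc R by (auto simp: sorted_wrt_iff_nth_less)
    next
      case (Suc a')
      thus ?thesis using abc R by (auto simp: avoids_132_def)
    qed
  qed
qed

text \<open>
  The maximum can only play the role of the \<open>3\<close>, which rules out ascents from \<open>L\<close> to \<open>R\<close>; once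
  there are none, no occurrence of the pattern can have its \<open>1\<close> in \<open>L\<close> and its \<open>2\<close> in \<open>R\<close>.
\<close>

lemma avoids_132_append_max:
  assumes "\<forall>x\<in>set L \<union> set R. x < M"
  shows "avoids_132 (L @ M # R) \<longleftrightarrow>
    avoids_132 L \<and> avoids_132 R \<and> (\<forall>x\<in>set L. \<forall>y\<in>set R. y \<le> x)"
  using assms
proof (induction L)
  case Nil
  hence "\<forall>y\<in>set R. y < M" by simp
  hence "sorted_wrt (\<lambda>b c. \<not> (M < c \<and> c < b)) R"
    by (intro sorted_wrt_mono_rel[OF _ sorted_wrt_true]) auto
  thus ?case by (simp add: avoids_132_Cons avoids_132_def[of "[]"])
next
  case (Cons x L)
  have IH: "avoids_132 (L @ M # R) \<longleftrightarrow>
    avoids_132 L \<and> avoids_132 R \<and> (\<forall>x\<in>set L. \<forall>y\<in>set R. y \<le> x)"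
    using Cons by simp
  define Q where "Q = (\<lambda>b c. \<not> (x < c \<and> c < b))"
  have lt: "\<forall>l\<in>set L. l < M" "\<forall>y\<in>set R. y < M" using Cons.prems by auto
  hence QLM: "\<forall>l\<in>set L. Q l M" by (auto simp: Q_def)
  (* With M in the middle role, the first entry x forbids every larger entry of R. *)
  have QMR: "(\<forall>y\<in>set R. Q M y) \<longleftrightarrow> (\<forall>y\<in>set R. y \<le> x)"
    using lt(2) by (force simp: Q_def not_less)
  have small: "Q b y" if "y \<le> x" for b y using that by (simp add: Q_def)
  have "sorted_wrt Q R" if "\<forall>y\<in>set R. y \<le> x"
    using that small by (intro sorted_wrt_mono_rel[OF _ sorted_wrt_true]) auto
  hence "sorted_wrt Q (L @ M # R) \<longleftrightarrow> sorted_wrt Q L \<and> (\<forall>y\<in>set R. y \<le> x)"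
    unfolding sorted_wrt_append sorted_wrt.simps list.set
    using QLM QMR small by blast
  thus ?case unfolding append_Cons avoids_132_Cons IH Q_def by auto
qed

lemma begins_increasing_append_max:
  assumes "\<forall>x\<in>set L \<union> set R. x < M"
  shows "begins_increasing k (L @ M # R) \<longleftrightarrow> k \<le> Suc (length L) \<and> sorted_wrt (<) (take k L)"
proof -
  consider "k \<le> length L" | "k = Suc (length L)" | j where "k = Suc (Suc (length L + j))"
    by (metis add_Suc_right le_SucE less_eq_Suc_le less_imp_Suc_add not_less_eq_eq add_Suc)
  thus ?thesis
  proof cases
    case 3
    (* Here the run would have to descend from M into R, or R is empty and the list too short. *)
    thus ?thesis
      using assms by (cases R) (auto simp: begins_increasing_def sorted_wrt_append
        dest: less_not_sym)
  qed (use assms in \<open>auto simp: begins_increasing_def sorted_wrt_append\<close>)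
qed

lemma avoids_132_shift: "avoids_132 (map ((+) m) p) \<longleftrightarrow> avoids_132 p"
  by (induction p) (simp_all add: avoids_132_Cons sorted_wrt_map avoids_132_def[of "[]"])

section \<open>The decomposition of avoiding permutations\<close>

definition avoiders :: "nat \<Rightarrow> nat \<Rightarrow> nat list set" where
  "avoiders k n = {p \<in> permutations_of_set {1..n}. avoids_132 p \<and> begins_increasing k p}"

lemma card_avoiders: "card (avoiders k n) = num_perms k n"
  by (simp add: avoiders_def num_perms_def)

lemma finite_avoiders [simp]: "finite (avoiders k n)"
  by (simp add: avoiders_def)

lemma avoiders_0_iff: "p \<in> avoiders 0 n \<longleftrightarrow> set p = {1..n} \<and> distinct p \<and> avoids_132 p"
  by (auto simp: avoiders_def permutations_of_set_def begins_increasing_def)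

lemma avoiders_iff: "p \<in> avoiders k n \<longleftrightarrow> p \<in> avoiders 0 n \<and> begins_increasing k p"
  by (auto simp: avoiders_def begins_increasing_def)

lemma length_avoiders: "p \<in> avoiders k n \<Longrightarrow> length p = n"
  using distinct_card[of p] by (auto simp: avoiders_def permutations_of_set_def)

text \<open>
  The avoiders that can stand before the maximum of a permutation beginning with \<open>12\<dots>k\<close>.  For
  \<open>k = Suc i\<close> the list \<open>take k L\<close> is \<open>L\<close> itself, and the maximum supplies the last
  entry of the run.
\<close>

definition left_parts :: "nat \<Rightarrow> nat \<Rightarrow> nat list set" where
  "left_parts k i = {L \<in> avoiders 0 i. k \<le> Suc i \<and> sorted_wrt (<) (take k L)}"

lemma avoids_132_upt: "avoids_132 [a..<b]"
  by (auto simp: avoids_132_def)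

lemma left_parts_eq:
  "left_parts k i = avoiders k i \<union> (if k = Suc i then {[1..<Suc i]} else {})"
proof -
  have set_upt: "set [1..<Suc i] = {1..i}"
    by (simp only: set_upt atLeastLessThanSuc_atLeastAtMost)
  have *: "L = [1..<Suc i]" if "set L = {1..i}" "sorted_wrt (<) L" for L
  proof (rule sorted_distinct_set_unique)
    show "sorted L" "distinct L" using that(2) by (simp_all only: strict_sorted_iff)
    show "set L = set [1..<Suc i]" by (simp only: that(1) set_upt)
  qed (rule sorted_upt distinct_upt)+
  have up: "[1..<Suc i] \<in> avoiders 0 i"
    by (simp only: avoiders_0_iff set_upt distinct_upt avoids_132_upt simp_thms)
  have "L \<in> left_parts k i \<longleftrightarrow> L \<in> avoiders k i \<or> k = Suc i \<and> L = [1..<Suc i]" for L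
  proof (cases "k = Suc i")
    case True
    have "L \<notin> avoiders k i"
      using True length_avoiders[of L k i] by (auto simp: avoiders_def begins_increasing_def)
    moreover have "L \<in> left_parts k i \<longleftrightarrow> L \<in> avoiders 0 i \<and> sorted_wrt (<) L"
      using True length_avoiders[of L 0 i] by (auto simp: left_parts_def)
    ultimately show ?thesis
      using True up *[of L] sorted_wrt_upt avoiders_0_iff by blast
  next
    case False
    thus ?thesis using length_avoiders[of L 0 i]
      by (auto simp: left_parts_def avoiders_iff[of L k] begins_increasing_def)
  qed
  thus ?thesis by (auto simp del: upt_Suc)
qed

lemma card_left_parts:
  "card (left_parts k i) = num_perms k i + (if k = Suc i then 1 else 0)"
proof (cases "k = Suc i")
  case True
  have "avoiders k i = {}"
    using True length_avoiders[of _ k i] by (auto simp: avoiders_def begins_increasing_def)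
  thus ?thesis using True by (simp add: left_parts_eq flip: card_avoiders)
qed (simp add: left_parts_eq card_avoiders)

text \<open>
  Both arguments are permutations of initial segments; the left one is shifted above the right one,
  which is the only relative position compatible with avoidance.
\<close>

definition glue :: "nat list \<times> nat list \<Rightarrow> nat list" where
  "glue = (\<lambda>(L, R). map ((+) (length R)) L @ Suc (length L + length R) # R)"

text \<open>
  This recovers the values in the right part: once all of it lies below the left part, its size
  alone determines which numbers it holds.
\<close>

lemma initial_segment_of_below:
  fixes A B :: "nat set"
  assumes un: "A \<union> B = {1..n}" and below: "\<And>a b. a \<in> A \<Longrightarrow> b \<in> B \<Longrightarrow> b < a"
  shows "B = {1..card B}"
proof (cases "B = {}")
  case False
  have fin: "finite B" using un by (metis finite_Un finite_atLeastAtMost)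
  have "B = {1..Max B}"
  proof
    show "B \<subseteq> {1..Max B}" using un fin by auto
    show "{1..Max B} \<subseteq> B"
    proof
      fix x assume x: "x \<in> {1..Max B}"
      have mx: "Max B \<in> B" using False fin by simp
      hence "Max B \<in> {1..n}" using un by blast
      hence "x \<in> {1..n}" using x by simp
      hence "x \<in> A \<union> B" by (simp only: un)
      thus "x \<in> B" using below[OF _ mx] x by fastforce
    qed
  qed
  thus ?thesis by (metis card_atLeastAtMost diff_Suc_1 One_nat_def)
qed simp

lemma glue_in_avoiders:
  assumes L: "L \<in> left_parts k i" and R: "R \<in> avoiders 0 j"
  shows "glue (L, R) \<in> avoiders k (Suc (i + j))"
proof -
  have L0: "L \<in> avoiders 0 i" and k: "k \<le> Suc i" "sorted_wrt (<) (take k L)"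
    using L by (auto simp: left_parts_def)
  have len: "length L = i" "length R = j" using L0 R by (auto dest: length_avoiders)
  define L' where "L' = map ((+) j) L"
  have g: "glue (L, R) = L' @ Suc (i + j) # R" by (simp add: glue_def len L'_def)
  have sL: "set L' = {Suc j..j + i}"
    using L0 by (simp add: L'_def avoiders_0_iff image_add_atLeastAtMost)
  have sR: "set R = {1..j}" using R by (simp add: avoiders_0_iff)
  have lt: "\<forall>x\<in>set L' \<union> set R. x < Suc (i + j)" using sL sR by auto
  have "distinct L'" using L0 by (simp add: L'_def avoiders_0_iff distinct_map)
  moreover have "avoids_132 (L' @ Suc (i + j) # R)"
    unfolding avoids_132_append_max[OF lt]
    using L0 R sL sR by (auto simp: L'_def avoids_132_shift avoiders_0_iff)
  moreover have "begins_increasing k (L' @ Suc (i + j) # R)"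
    unfolding begins_increasing_append_max[OF lt]
    using k len by (simp add: L'_def take_map sorted_wrt_map)
  ultimately show ?thesis
    unfolding g avoiders_iff[of _ k] avoiders_0_iff
    using R sL sR by (auto simp: avoiders_0_iff)
qed

lemma avoiders_Suc_obtain:
  assumes p: "p \<in> avoiders k (Suc n)"
  obtains i L R where "i \<le> n" "L \<in> left_parts k i" "R \<in> avoiders 0 (n - i)" "p = glue (L, R)"
proof -
  have set_p: "set p = {1..Suc n}" and dist: "distinct p" and av: "avoids_132 p"
    and beg: "begins_increasing k p"
    using p by (auto simp: avoiders_iff[of p k] avoiders_0_iff)
  have "Suc n \<in> set p" using set_p by simp
  then obtain L' R where dec: "p = L' @ Suc n # R" by (auto dest: split_list)
  have un: "set L' \<union> set R = {1..n}"
  proof -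
    have "set L' \<union> set R = set p - {Suc n}" using dist by (auto simp: dec)
    also have "\<dots> = {1..n}" unfolding set_p by auto
    finally show ?thesis .
  qed
  have lt: "\<forall>x\<in>set L' \<union> set R. x < Suc n" using un by auto
  have av': "avoids_132 L'" "avoids_132 R" and below: "\<And>x y. x \<in> set L' \<Longrightarrow> y \<in> set R \<Longrightarrow> y < x"
    using av dist unfolding dec avoids_132_append_max[OF lt]
    by (auto simp: le_less)
  have beg': "k \<le> Suc (length L')" "sorted_wrt (<) (take k L')"
    using beg unfolding dec begins_increasing_append_max[OF lt] by auto
  define i m where "i = length L'" and "m = length R"
  have cR: "card (set R) = m" using dist by (simp add: dec m_def distinct_card)
  have sR: "set R = {1..m}"
    using initial_segment_of_below[OF un below] cR by simp
  have n: "n = i + m"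
    using distinct_card[OF dist] unfolding set_p by (simp add: dec i_def m_def)
  have sL: "set L' = {Suc m..m + i}"
  proof -
    have "set L' = {1..n} - {1..m}" using un dist sR by (auto simp: dec)
    also have "\<dots> = {Suc m..m + i}" unfolding n by auto
    finally show ?thesis .
  qed
  define L where "L = map (\<lambda>x. x - m) L'"
  have L': "L' = map ((+) m) L"
    unfolding L_def map_map by (rule map_idI[symmetric]) (use sL in auto)
  have "distinct L" using dist by (simp add: dec L' distinct_map)
  moreover have "set L = {1..i}"
  proof -
    have "(+) m ` set L = set L'" by (simp only: L' set_map)
    also have "\<dots> = (+) m ` {1..i}" by (simp add: sL image_add_atLeastAtMost)
    finally show ?thesis by (simp only: inj_image_eq_iff inj_on_add)
  qed
  ultimately have "L \<in> left_parts k i"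
    using av'(1) beg'
    by (simp add: left_parts_def avoiders_0_iff L' avoids_132_shift i_def take_map sorted_wrt_map)
  moreover have "R \<in> avoiders 0 (n - i)"
    using av'(2) sR n dist by (simp add: avoiders_0_iff dec)
  moreover have "p = glue (L, R)"
    using n by (simp add: glue_def dec L' i_def m_def)
  ultimately show ?thesis using that[of i L R] n by simp
qed

lemma inj_on_glue: "inj_on glue (\<Union>i\<le>n. left_parts k i \<times> avoiders 0 (n - i))"
proof (rule inj_onI, clarify)
  fix i j L R L' R'
  assume i: "i \<le> n" "L \<in> left_parts k i" "R \<in> avoiders 0 (n - i)"
    and j: "j \<le> n" "L' \<in> left_parts k j" "R' \<in> avoiders 0 (n - j)"
    and eq: "glue (L, R) = glue (L', R')"
  have len: "length L = i" "length R = n - i" "length L' = j" "length R' = n - j"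
    using i j by (auto simp: left_parts_def dest: length_avoiders)
  have sets: "set L = {1..i}" "set R = {1..n - i}"
    using i by (auto simp: left_parts_def avoiders_0_iff)
  (* The maximum Suc n occurs only once, which fixes the place of the cut. *)
  have "map ((+) (n - i)) L @ Suc n # R = map ((+) (n - j)) L' @ Suc n # R'"
    using eq i(1) j(1) by (simp add: glue_def len)
  hence "map ((+) (n - i)) L = map ((+) (n - j)) L' \<and> R = R'"
    by (subst (asm) append_Cons_eq_iff) (use sets i(1) in auto)
  moreover from this have "n - i = n - j" using len by metis
  ultimately show "L = L' \<and> R = R'" by (simp add: inj_map_eq_map)
qed

lemma bij_betw_glue:
  "bij_betw glue (\<Union>i\<le>n. left_parts k i \<times> avoiders 0 (n - i)) (avoiders k (Suc n))"
proof -
  have "glue ` (\<Union>i\<le>n. left_parts k i \<times> avoiders 0 (n - i)) \<subseteq> avoiders k (Suc n)"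
  proof clarify
    fix i L R
    assume "i \<le> n" "L \<in> left_parts k i" "R \<in> avoiders 0 (n - i)"
    thus "glue (L, R) \<in> avoiders k (Suc n)"
      using glue_in_avoiders[of L k i R "n - i"] by simp
  qed
  moreover have "avoiders k (Suc n) \<subseteq> glue ` (\<Union>i\<le>n. left_parts k i \<times> avoiders 0 (n - i))"
  proof
    fix p assume "p \<in> avoiders k (Suc n)"
    then obtain i L R where
      "i \<le> n" "L \<in> left_parts k i" "R \<in> avoiders 0 (n - i)" "p = glue (L, R)"
      by (rule avoiders_Suc_obtain)
    thus "p \<in> glue ` (\<Union>i\<le>n. left_parts k i \<times> avoiders 0 (n - i))" by blast
  qed
  ultimately show ?thesis
    unfolding bij_betw_def using inj_on_glue by blast
qed

section \<open>Generating functions\<close>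

lemma num_perms_Suc:
  "num_perms k (Suc n) =
    (\<Sum>i\<le>n. (num_perms k i + (if k = Suc i then 1 else 0)) * num_perms 0 (n - i))"
proof -
  have fin: "finite (left_parts k i)" for i by (simp add: left_parts_def)
  have "num_perms k (Suc n) = card (\<Union>i\<le>n. left_parts k i \<times> avoiders 0 (n - i))"
    using bij_betw_same_card[OF bij_betw_glue] by (simp add: card_avoiders)
  also have "\<dots> = (\<Sum>i\<le>n. card (left_parts k i \<times> avoiders 0 (n - i)))"
  proof (rule card_UN_disjoint)
    show "\<forall>i\<in>{..n}. \<forall>j\<in>{..n}. i \<noteq> j \<longrightarrow>
      (left_parts k i \<times> avoiders 0 (n - i)) \<inter> (left_parts k j \<times> avoiders 0 (n - j)) = {}"
      by (auto simp: left_parts_def dest!: length_avoiders)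
  qed (simp_all add: fin)
  finally show ?thesis
    by (simp add: card_cartesian_product card_left_parts card_avoiders)
qed

text \<open>
  In contrast to \<open>perm_gf\<close>, this series counts the empty permutation for \<open>k = 0\<close>, as the factors
  of a decomposition may be empty.
\<close>

definition avoiders_gf :: "nat \<Rightarrow> real fps" where
  "avoiders_gf k = Abs_fps (\<lambda>n. of_nat (num_perms k n))"

lemma num_perms_0: "num_perms k 0 = (if k = 0 then 1 else 0)"
proof -
  have "avoiders k 0 = (if k = 0 then {[]} else {})"
    by (auto simp: avoiders_def begins_increasing_def avoids_132_def)
  thus ?thesis by (simp flip: card_avoiders)
qed

text \<open>
  The first factor of the product counts the possible left parts: the avoiders that already begin
  with \<open>12\<dots>k\<close>, and for \<open>k \<ge> 1\<close> the single increasing list that the maximum extends to length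
  \<open>k\<close>.  The second one counts the right parts, \<open>fps_X\<close> marks the maximum, and the initial summand
  is the empty permutation.
\<close>

lemma avoiders_gf_eq:
  "avoiders_gf k = (if k = 0 then 1 else 0) +
    fps_X * ((avoiders_gf k + (if k = 0 then 0 else fps_X ^ (k - 1))) * avoiders_gf 0)"
proof (rule fps_ext)
  fix n
  show "fps_nth (avoiders_gf k) n = fps_nth ((if k = 0 then 1 else 0) +
    fps_X * ((avoiders_gf k + (if k = 0 then 0 else fps_X ^ (k - 1))) * avoiders_gf 0)) n"
  proof (cases n)
    case 0
    thus ?thesis by (simp add: avoiders_gf_def num_perms_0)
  next
    case (Suc m)
    define W :: "real fps" where
      "W = avoiders_gf k + (if k = 0 then 0 else fps_X ^ (k - 1))"
    have W: "fps_nth W i = of_nat (num_perms k i + (if k = Suc i then 1 else 0))" for i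
      by (cases k) (auto simp: W_def avoiders_gf_def)
    have "fps_nth (avoiders_gf k) (Suc m) = fps_nth (W * avoiders_gf 0) m"
      unfolding fps_mult_nth W
      by (simp only: avoiders_gf_def fps_nth_Abs_fps num_perms_Suc atMost_atLeast0
          of_nat_sum of_nat_mult)
    thus ?thesis by (simp add: Suc flip: W_def)
  qed
qed

lemma perm_gf_eq_avoiders_gf: "k \<ge> 1 \<Longrightarrow> perm_gf k = avoiders_gf k"
  by (rule fps_ext) (simp add: perm_gf_def avoiders_gf_def num_perms_0)

text \<open>This follows by squaring \<open>1 - 2 x C = sqrt (1 - 4 x)\<close> and cancelling \<open>4 x\<close>.\<close>

lemma catalan_gf_quadratic: "catalan_gf = 1 + fps_X * catalan_gf ^ 2"
proof -
  define s where "s = fps_radical root 2 (1 - 4 * fps_X :: real fps)"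
  have s2: "s ^ 2 = 1 - 4 * fps_X"
    using power_radical[of "1 - 4 * fps_X :: real fps" root 1]
    by (simp add: s_def numeral_2_eq_2)
  have "fps_nth s 0 = 1"
    by (simp add: s_def numeral_2_eq_2)
  hence t: "1 - s = fps_X * fps_shift 1 (1 - s)"
    by (intro fps_ext) simp
  have "catalan_gf * (2 * fps_X) = 1 - s"
  proof -
    have "1 - s = fps_const (2 * (1/2)) * (fps_X * fps_shift 1 (1 - s))" using t by simp
    also have "\<dots> = 2 * fps_X * (fps_const (1/2) * fps_shift 1 (1 - s))"
      by (simp only: numeral_fps_const mult_ac flip: fps_const_mult)
    finally have "2 * fps_X dvd 1 - s" by (rule dvdI)
    thus ?thesis by (simp add: catalan_gf_closed_form s_def)
  qed
  hence s: "s = 1 - 2 * fps_X * catalan_gf" by (simp add: algebra_simps)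
  have "(4 * fps_X) * (catalan_gf - (1 + fps_X * catalan_gf ^ 2))
      = (1 - 4 * fps_X) - (1 - 2 * fps_X * catalan_gf) ^ 2"
    by (simp add: power2_eq_square algebra_simps)
  also have "\<dots> = 0" using s2 by (simp only: s diff_self)
  finally show ?thesis by simp
qed

text \<open>
  The difference of two solutions is annihilated by \<open>1 - x (A + B)\<close>, whose constant
  coefficient is \<open>1\<close>.
\<close>

lemma fps_quadratic_unique:
  fixes A B :: "'a::idom fps"
  assumes A: "A = 1 + fps_X * A ^ 2" and B: "B = 1 + fps_X * B ^ 2"
  shows "A = B"
proof -
  have "A - B = (1 + fps_X * A ^ 2) - (1 + fps_X * B ^ 2)" using A B by simp
  hence "(A - B) * (1 - fps_X * (A + B)) = 0"
    by (simp add: algebra_simps power2_eq_square)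
  moreover have "1 - fps_X * (A + B) \<noteq> 0"
  proof
    assume "1 - fps_X * (A + B) = 0"
    hence "fps_nth (1 - fps_X * (A + B)) 0 = 0" by simp
    thus False by simp
  qed
  ultimately show ?thesis by simp
qed

lemma avoiders_gf_0: "avoiders_gf 0 = catalan_gf"
proof (rule fps_quadratic_unique)
  show "avoiders_gf 0 = 1 + fps_X * avoiders_gf 0 ^ 2"
    using avoiders_gf_eq[of 0] by (simp only: power2_eq_square simp_thms if_True add_0_right)
qed (rule catalan_gf_quadratic)

theorem proposition4:
  fixes k :: nat
  assumes "k \<ge> 1"
  shows "perm_gf k = fps_X ^ k * catalan_gf ^ 2"
proof -
  define G where "G = avoiders_gf k"
  define C where "C = catalan_gf"
  have "G = fps_X * ((G + fps_X ^ (k - 1)) * C)"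
    using avoiders_gf_eq[of k] assms by (simp add: avoiders_gf_0 G_def C_def)
  also have "\<dots> = fps_X * C * G + fps_X ^ k * C"
    using assms by (cases k) (simp_all add: algebra_simps)
  finally have G: "G * (1 - fps_X * C) = fps_X ^ k * C"
    by (simp add: algebra_simps)
  have C: "(1 - fps_X * C) * C = 1"
    using catalan_gf_quadratic by (simp add: algebra_simps power2_eq_square C_def)
  have "G = G * ((1 - fps_X * C) * C)" by (simp add: C)
  also have "\<dots> = fps_X ^ k * C ^ 2"
    by (simp add: G power2_eq_square flip: mult.assoc)
  finally show ?thesis
    using assms by (simp add: perm_gf_eq_avoiders_gf G_def C_def)
qed

end
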